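(* Let $G$ be an $(n,d,\lambda)$-graph. Then for every node $s$ of $G$ and every $0<\delta<1$, for at least $(1-\delta)n$ nodes $t$ of $G$ it holds that bidirectional BFS between $s$ and $t$ finds a shortest $s$-$t$ path after visiting $O\big((d-1)^{\lceil (1/4)\lg_{d/\lambda}(n/\delta)\rceil}\big)$ nodes.
   Context: An $n$-node graph $G$ is an $(n,d,\lambda)$-graph if it is $d$-regular (every node has degree $d$) and the eigenvalues $\lambda_1\ge\cdots\ge\lambda_n$ of its adjacency matrix satisfy $\max_{i\neq 1}|\lambda_i|\le\lambda$. $\lg_b$ denotes the logarithm to base $b$. Bidirectional BFS between $s$ and $t$: simultaneously grow a BFS tree $\mathcal{T}_s$ from $s$ and a BFS tree $\mathcal{T}_t$ from $t$, in each iteration computing the next layer of both trees; as soon as some node $v$ appears in both trees, output the path $s\to v\to t$ formed by the tree paths. Nodes are indexed by $[n]$ and the algorithm has random access to the neighbors of any node.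
   Formalization: The formal theorem assumes 0 < λ < d, so that the logarithm has base greater than 1, and excludes d = 2, where the claimed bound is O(1) and fails for long odd cycles. *)

theory Defs
  imports
    "HOL-Library.While_Combinator"
    "Graph_Theory.Pair_Digraph"
    "Graph_Theory.Vertex_Walk"
    "Jordan_Normal_Form.Char_Poly"
begin

section \<open>Graphs with bounded second eigenvalue\<close>

definition adjacency_matrix :: "nat \<Rightarrow> nat pair_pre_digraph \<Rightarrow> real mat" where
  "adjacency_matrix n G = mat n n (\<lambda>(i, j). if (i, j) \<in> parcs G then 1 else 0)"

text \<open>The eigenvalues with algebraic multiplicity, in non-increasing order. Such a list is
  unique if it exists; a real symmetric matrix always has one.\<close>

definition eigenvalue_list :: "real mat \<Rightarrow> real list \<Rightarrow> bool" where
  "eigenvalue_list A es \<longleftrightarrow>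
     char_poly A = (\<Prod>e\<leftarrow>es. [:- e, 1:]) \<and> sorted_wrt (\<ge>) es"

text \<open>Undirected simple graphs are symmetric loop-free digraphs (\<^locale>\<open>pair_graph\<close>).
  Lists are indexed from 0, so the largest eigenvalue is \<^term>\<open>es ! 0\<close>.\<close>

definition ndl_graph :: "nat \<Rightarrow> nat \<Rightarrow> real \<Rightarrow> nat pair_pre_digraph \<Rightarrow> bool" where
  "ndl_graph n d lam G \<longleftrightarrow>
     pair_graph G \<and> pverts G = {..<n} \<and>
     (\<forall>v\<in>pverts G. out_degree (with_proj G) v = d) \<and>
     (\<exists>es. eigenvalue_list (adjacency_matrix n G) es \<and> (\<forall>i\<in>{1..<n}. \<bar>es ! i\<bar> \<le> lam))"

definition shortest_walk :: "'a pair_pre_digraph \<Rightarrow> 'a \<Rightarrow> 'a \<Rightarrow> 'a vwalk \<Rightarrow> bool" where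
  "shortest_walk G s t p \<longleftrightarrow>
     vwalk p (with_proj G) \<and> hd p = s \<and> last p = t \<and>
     (\<forall>q. vwalk q (with_proj G) \<and> hd q = s \<and> last q = t \<longrightarrow> vwalk_length p \<le> vwalk_length q)"


section \<open>Bidirectional breadth-first search\<close>

definition adjacency_lists :: "'a pair_pre_digraph \<Rightarrow> ('a \<Rightarrow> 'a list) \<Rightarrow> bool" where
  "adjacency_lists G nbrs \<longleftrightarrow>
     (\<forall>v\<in>pverts G. distinct (nbrs v) \<and> set (nbrs v) = {w. (v, w) \<in> parcs G})"

text \<open>A rooted tree is stored as the map from each of its nodes to the tree path from the
  root to that node, so attaching \<open>v\<close> below \<open>u\<close> maps \<open>v\<close> to the path of \<open>u\<close> extended by \<open>v\<close>.\<close>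

type_synonym 'a bfs_tree = "'a \<rightharpoonup> 'a list"

text \<open>\<open>scan Oth es T L\<close> processes the pairs (node of the last layer, neighbour) one by one,
  adding undiscovered neighbours to the tree \<open>T\<close> and to its new layer \<open>L\<close>. It stops at the
  first new node that lies in the other tree \<open>Oth\<close>, and then returns this node as well.\<close>

fun scan :: "'a bfs_tree \<Rightarrow> ('a \<times> 'a) list \<Rightarrow> 'a bfs_tree \<Rightarrow> 'a list
    \<Rightarrow> 'a bfs_tree \<times> 'a list \<times> 'a option" where
  "scan Oth [] T L = (T, L, None)"
| "scan Oth ((u, v) # es) T L =
     (if v \<in> dom T then scan Oth es T L
      else let T' = T(v \<mapsto> the (T u) @ [v]); L' = L @ [v] in
        if v \<in> dom Oth then (T', L', Some v) else scan Oth es T' L')"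

definition grow_layer :: "('a \<Rightarrow> 'a list) \<Rightarrow> 'a bfs_tree \<Rightarrow> 'a bfs_tree \<Rightarrow> 'a list
    \<Rightarrow> 'a bfs_tree \<times> 'a list \<times> 'a option" where
  "grow_layer nbrs Oth T L = scan Oth [(u, v). u \<leftarrow> L, v \<leftarrow> nbrs u] T []"

record 'a bibfs_state =
  tree_s :: "'a bfs_tree"
  layer_s :: "'a list"
  tree_t :: "'a bfs_tree"
  layer_t :: "'a list"
  meet :: "'a option"

definition bibfs_init :: "'a \<Rightarrow> 'a \<Rightarrow> 'a bibfs_state" where
  "bibfs_init s t =
     \<lparr>tree_s = [s \<mapsto> [s]], layer_s = [s], tree_t = [t \<mapsto> [t]], layer_t = [t],
      meet = (if s = t then Some s else None)\<rparr>"

text \<open>One iteration adds a layer to the first tree and then one to the second. Testing for a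
  common node already between (and within) the two layers matters: after completing both layers
  an arbitrary common node need not lie on a shortest path.\<close>

definition bibfs_step :: "('a \<Rightarrow> 'a list) \<Rightarrow> 'a bibfs_state \<Rightarrow> 'a bibfs_state" where
  "bibfs_step nbrs \<sigma> =
     (case grow_layer nbrs (tree_t \<sigma>) (tree_s \<sigma>) (layer_s \<sigma>) of
        (S, LS, Some v) \<Rightarrow> \<sigma>\<lparr>tree_s := S, layer_s := LS, meet := Some v\<rparr>
      | (S, LS, None) \<Rightarrow>
          (case grow_layer nbrs S (tree_t \<sigma>) (layer_t \<sigma>) of
             (T, LT, m) \<Rightarrow>
               \<lparr>tree_s = S, layer_s = LS, tree_t = T, layer_t = LT, meet = m\<rparr>))"

text \<open>An empty layer means that a whole connected component has been explored without
  meeting the other tree; the search then ends without a path.\<close>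

definition bibfs :: "('a \<Rightarrow> 'a list) \<Rightarrow> 'a \<Rightarrow> 'a \<Rightarrow> 'a bibfs_state option" where
  "bibfs nbrs s t =
     while_option (\<lambda>\<sigma>. meet \<sigma> = None \<and> layer_s \<sigma> \<noteq> [] \<and> layer_t \<sigma> \<noteq> [])
       (bibfs_step nbrs) (bibfs_init s t)"

definition bibfs_path :: "'a bibfs_state \<Rightarrow> 'a list option" where
  "bibfs_path \<sigma> =
     map_option (\<lambda>v. the (tree_s \<sigma> v) @ tl (rev (the (tree_t \<sigma> v)))) (meet \<sigma>)"

definition visited :: "'a bibfs_state \<Rightarrow> 'a set" where
  "visited \<sigma> = dom (tree_s \<sigma>) \<union> dom (tree_t \<sigma>)"

text \<open>Quantifying over all adjacency lists makes this independent of the order in which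
  neighbours are scanned.\<close>

definition bibfs_finds_shortest_within ::
    "'a pair_pre_digraph \<Rightarrow> 'a \<Rightarrow> 'a \<Rightarrow> real \<Rightarrow> bool" where
  "bibfs_finds_shortest_within G s t b \<longleftrightarrow>
     (\<forall>nbrs. adjacency_lists G nbrs \<longrightarrow>
        (\<exists>\<sigma> p. bibfs nbrs s t = Some \<sigma> \<and> bibfs_path \<sigma> = Some p \<and>
               shortest_walk G s t p \<and> real (card (visited \<sigma>)) \<le> b))"

end

theory Submission
  imports Defs "Jordan_Normal_Form.Schur_Decomposition"
begin

text \<open>Write \<open>A\<close> for the adjacency matrix and \<open>J\<close> for the all-ones matrix. The vector
  \<open>(A - (d / n) J) ^ k e\<^sub>s\<close> (\<open>k > 0\<close>) has squared norm at most \<open>lam ^ (2 * k)\<close>, and its entry at \<open>t\<close> is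
  \<open>- d ^ k / n\<close> whenever no walk of length \<open>k\<close> joins \<open>s\<close> and \<open>t\<close>. Hence there are at most
  \<open>n\<^sup>2 (lam / d) ^ (2 * k)\<close> such nodes \<open>t\<close>, which is at most \<open>\<delta> n\<close> for \<open>k = 2 * m\<close>, where \<open>m\<close> is
  the exponent of the theorem. All other \<open>t\<close> have distance at most \<open>2 * m\<close> from \<open>s\<close>, so that
  the two search trees meet within \<open>m\<close> iterations, and each of them stays inside a ball of
  radius \<open>m\<close>, which has at most \<open>3 (d - 1) ^ m\<close> nodes if \<open>d \<ge> 3\<close>.\<close>

section \<open>Powers of regular symmetric matrices\<close>

lemma pow_mat_add:
  fixes A :: "'a::semiring_1 mat"
  assumes "A \<in> carrier_mat n n"
  shows "A ^\<^sub>m (j + k) = A ^\<^sub>m j * A ^\<^sub>m k"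
proof (induction k)
  case 0
  then show ?case using assms by simp
next
  case (Suc k)
  then show ?case
    using assms by (simp add: assoc_mult_mat[of _ n n _ n _ n])
qed

lemma index_mult_mat_sum:
  assumes "A \<in> carrier_mat n m" "B \<in> carrier_mat m r" "i < n" "j < r"
  shows "(A * B) $$ (i, j) = (\<Sum>k<m. A $$ (i, k) * B $$ (k, j))"
  using assms by (simp add: scalar_prod_def atLeast0LessThan)

text \<open>Puts the \<open>k\<close>-th powers of the eigenvalues on the diagonal once
  \<open>B\<close> is a Schur form.\<close>

lemma upper_triangular_pow_mat:
  fixes B :: "'a::comm_ring_1 mat"
  assumes B: "B \<in> carrier_mat n n" and ut: "upper_triangular B"
  shows "upper_triangular (B ^\<^sub>m k) \<and> (\<forall>i<n. (B ^\<^sub>m k) $$ (i, i) = B $$ (i, i) ^ k)"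
proof (induction k)
  case 0
  then show ?case using B by auto
next
  case (Suc k)
  have Bk: "B ^\<^sub>m k \<in> carrier_mat n n" using B by simp
  have van: "(B ^\<^sub>m k) $$ (i, l) * B $$ (l, j) = 0" if "i < n" "l < n" "l < i \<or> j < l" for i j l
    using that Suc ut B Bk by (auto simp: upper_triangular_def)
  have "(B ^\<^sub>m Suc k) $$ (i, j) = 0" if "j < i" "i < n" for i j
  proof -
    have "(B ^\<^sub>m Suc k) $$ (i, j) = (\<Sum>l<n. (B ^\<^sub>m k) $$ (i, l) * B $$ (l, j))"
      using index_mult_mat_sum[OF Bk B] that by simp
    also have "\<dots> = 0" using that by (intro sum.neutral ballI van) auto
    finally show ?thesis .
  qed
  moreover have "(B ^\<^sub>m Suc k) $$ (i, i) = B $$ (i, i) ^ Suc k" if "i < n" for i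
  proof -
    have "(B ^\<^sub>m Suc k) $$ (i, i) = (\<Sum>l<n. (B ^\<^sub>m k) $$ (i, l) * B $$ (l, i))"
      using index_mult_mat_sum[OF Bk B] that by simp
    also have "\<dots> = (\<Sum>l\<in>{i}. (B ^\<^sub>m k) $$ (i, l) * B $$ (l, i))"
      using that by (intro sum.mono_neutral_right) (auto intro!: van simp: less_le)
    finally show ?thesis using Suc that by (simp add: mult.commute)
  qed
  ultimately show ?case using B by (auto simp: upper_triangular_def)
qed

text \<open>Cyclicity of the trace: both sides are the same double sum, taken in different
  orders.\<close>

lemma sum_diag_mult_commute:
  fixes A B :: "'a::comm_ring_1 mat"
  assumes "A \<in> carrier_mat n n" "B \<in> carrier_mat n n"
  shows "(\<Sum>i<n. (A * B) $$ (i, i)) = (\<Sum>i<n. (B * A) $$ (i, i))"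
proof -
  have "(\<Sum>i<n. (A * B) $$ (i, i)) = (\<Sum>i<n. \<Sum>k<n. A $$ (i, k) * B $$ (k, i))"
    by (intro sum.cong refl index_mult_mat_sum[OF assms]) auto
  also have "\<dots> = (\<Sum>k<n. \<Sum>i<n. B $$ (k, i) * A $$ (i, k))"
    by (subst sum.swap) (simp add: mult.commute)
  also have "\<dots> = (\<Sum>k<n. (B * A) $$ (k, k))"
    by (intro sum.cong refl index_mult_mat_sum[OF assms(2,1), symmetric]) auto
  finally show ?thesis .
qed

text \<open>A Schur decomposition \<open>A = P * B * Q\<close> has \<open>es\<close> on the diagonal
  of \<open>B\<close>, and cyclicity of the trace removes \<open>P\<close> and \<open>Q\<close> from
  \<open>P * B ^ k * Q\<close>.\<close>

lemma trace_pow_mat_eq_sum_eigenvalues: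
  fixes A :: "'a::conjugatable_ordered_field mat"
  assumes A: "A \<in> carrier_mat n n" and es: "char_poly A = (\<Prod>e\<leftarrow>es. [:- e, 1:])"
  shows "(\<Sum>i<n. (A ^\<^sub>m k) $$ (i, i)) = (\<Sum>e\<leftarrow>es. e ^ k)"
proof -
  obtain B P Q where dec: "schur_decomposition A es = (B, P, Q)"
    by (cases "schur_decomposition A es") auto
  note schur = schur_decomposition[OF A es dec]
  from schur have sim: "similar_mat_wit A B P Q" by simp
  note D = similar_mat_witD2[OF A sim]
  have Bk: "B ^\<^sub>m k \<in> carrier_mat n n" using D by simp
  have "(\<Sum>i<n. (A ^\<^sub>m k) $$ (i, i)) = (\<Sum>i<n. (P * (B ^\<^sub>m k * Q)) $$ (i, i))"
    using similar_mat_wit_pow_id[OF sim] D Bk by (simp add: assoc_mult_mat[of _ n n _ n _ n])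
  also have "\<dots> = (\<Sum>i<n. (B ^\<^sub>m k * Q * P) $$ (i, i))"
    using D Bk by (intro sum_diag_mult_commute) auto
  also have "B ^\<^sub>m k * Q * P = B ^\<^sub>m k"
    using D Bk by (simp add: assoc_mult_mat[of _ n n _ n _ n])
  also have "(\<Sum>i<n. (B ^\<^sub>m k) $$ (i, i)) = (\<Sum>i<n. B $$ (i, i) ^ k)"
    using upper_triangular_pow_mat[of B n k] schur D by (intro sum.cong) auto
  also have "\<dots> = (\<Sum>e\<leftarrow>diag_mat B. e ^ k)"
    using D by (simp add: diag_mat_def o_def interv_sum_list_conv_sum_set_nat atLeast0LessThan)
  finally show ?thesis using schur by simp
qed

text \<open>The even exponent turns bounds on absolute values into bounds on powers. The eigenvalue
  \<open>d\<close> keeps its exact term, which the all-ones part of \<open>A\<close> cancels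
  later.\<close>

lemma sum_eigenvalues_pow_le:
  fixes A :: "real mat" and d lam :: real
  assumes A: "A \<in> carrier_mat n n" and es: "eigenvalue_list A es"
    and lam: "\<forall>i\<in>{1..<n}. \<bar>es ! i\<bar> \<le> lam" "lam < d" and d: "eigenvalue A d"
  shows "(\<Sum>e\<leftarrow>es. e ^ (2 * k)) \<le> d ^ (2 * k) + (real n - 1) * lam ^ (2 * k)"
proof -
  have cp: "char_poly A = (\<Prod>e\<leftarrow>es. [:- e, 1:])" using es by (simp add: eigenvalue_list_def)
  have "degree (\<Prod>e\<leftarrow>es. [:- e, 1:]) = length es"
    by (rule degree_linear_factors)
  then have len: "length es = n" using degree_monic_char_poly[OF A] cp by simp
  have "poly (char_poly A) d = 0" using d eigenvalue_root_char_poly[OF A] by simp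
  then have "d \<in> set es" unfolding cp poly_prod_list by (auto simp: prod_list_zero_iff)
  then obtain i where i: "i < n" "es ! i = d" using len by (auto simp: in_set_conv_nth)
  \<comment> \<open>Every other position carries a value of at most \<open>lam\<close>, which is
    below \<open>d\<close>.\<close>
  with lam have "i = 0" by (cases i) force+
  with i have n: "0 < n" "es ! 0 = d" by auto
  have "(\<Sum>e\<leftarrow>es. e ^ (2 * k)) = (\<Sum>i<n. (es ! i) ^ (2 * k))"
    by (subst sum_list_sum_nth) (simp add: len atLeast0LessThan)
  also have "\<dots> = d ^ (2 * k) + (\<Sum>i\<in>{1..<n}. (es ! i) ^ (2 * k))"
    using n by (subst lessThan_atLeast0, subst sum.atLeast_Suc_lessThan) auto
  also have "(\<Sum>i\<in>{1..<n}. (es ! i) ^ (2 * k)) \<le> (\<Sum>i\<in>{1..<n}. lam ^ (2 * k))"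
  proof (rule sum_mono)
    fix i assume "i \<in> {1..<n}"
    then have "\<bar>es ! i\<bar> ^ (2 * k) \<le> lam ^ (2 * k)" using lam by (intro power_mono) auto
    then show "(es ! i) ^ (2 * k) \<le> lam ^ (2 * k)" by (simp add: power_even_abs)
  qed
  also have "\<dots> = (real n - 1) * lam ^ (2 * k)" using n by (simp add: of_nat_diff)
  finally show ?thesis by simp
qed

text \<open>A number above 1 has unbounded powers, also along the exponents \<open>2 ^ i\<close>.
  Applied to a ratio, this discards a constant factor \<open>B\<close>.\<close>

lemma le_one_if_powers_bounded:
  fixes x :: real
  assumes "\<And>i. x ^ (2 ^ i) \<le> B"
  shows "x \<le> 1"
proof (rule ccontr)
  assume "\<not> x \<le> 1"
  then obtain m where m: "B < x ^ m" using real_arch_pow[of x B] by auto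
  have "x ^ m \<le> x ^ (2 ^ m)" using \<open>\<not> x \<le> 1\<close> by (intro power_increasing) (auto intro: less_imp_le)
  with m assms[of m] show False by simp
qed

section \<open>Walk counts compared with the uniform value \<open>d ^ k / n\<close>\<close>

locale regular_symmetric_matrix =
  fixes n :: nat and A :: "real mat" and d :: real
  assumes A: "A \<in> carrier_mat n n"
    and sym: "transpose_mat A = A"
    and row_sum: "i < n \<Longrightarrow> (\<Sum>j<n. A $$ (i, j)) = d"
    and n: "0 < n"
begin

lemma pow_carrier: "A ^\<^sub>m k \<in> carrier_mat n n"
  using A by simp

lemma pow_index_add:
  "i < n \<Longrightarrow> j < n \<Longrightarrow>
    (A ^\<^sub>m (k + l)) $$ (i, j) = (\<Sum>t<n. (A ^\<^sub>m k) $$ (i, t) * (A ^\<^sub>m l) $$ (t, j))"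
  using index_mult_mat_sum[OF pow_carrier pow_carrier] by (simp add: pow_mat_add[OF A])

text \<open>A factor \<open>A\<close> may be split off a power at either end, and \<open>A\<close>
  is symmetric.\<close>

lemma pow_index_sym:
  assumes "i < n" "j < n"
  shows "(A ^\<^sub>m k) $$ (i, j) = (A ^\<^sub>m k) $$ (j, i)"
  using assms
proof (induction k arbitrary: i j)
  case 0
  then show ?case using A by auto
next
  case (Suc k)
  have A1: "A ^\<^sub>m 1 = A" using A by simp
  have sA: "A $$ (a, b) = A $$ (b, a)" if "a < n" "b < n" for a b
    using that A sym by (metis carrier_matD index_transpose_mat(1))
  have "(A ^\<^sub>m Suc k) $$ (i, j) = (\<Sum>t<n. (A ^\<^sub>m k) $$ (i, t) * A $$ (t, j))"
    using pow_index_add[of i j k 1] Suc.prems unfolding A1 by simp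
  also have "\<dots> = (\<Sum>t<n. A $$ (j, t) * (A ^\<^sub>m k) $$ (t, i))"
    using Suc sA by (intro sum.cong) (auto simp: mult.commute)
  also have "\<dots> = (A ^\<^sub>m Suc k) $$ (j, i)"
    using pow_index_add[of j i 1 k] Suc.prems unfolding A1 by simp
  finally show ?case .
qed

lemma pow_row_sum: "i < n \<Longrightarrow> (\<Sum>j<n. (A ^\<^sub>m k) $$ (i, j)) = d ^ k"
proof (induction k)
  case 0
  then show ?case using A by (simp add: if_distrib sum.delta cong: if_cong)
next
  case (Suc k)
  have A1: "A ^\<^sub>m 1 = A" using A by simp
  have "(\<Sum>j<n. (A ^\<^sub>m Suc k) $$ (i, j)) = (\<Sum>j<n. \<Sum>t<n. (A ^\<^sub>m k) $$ (i, t) * A $$ (t, j))"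
    using pow_index_add[of i _ k 1] Suc.prems unfolding A1 by simp
  also have "\<dots> = (\<Sum>t<n. (A ^\<^sub>m k) $$ (i, t) * (\<Sum>j<n. A $$ (t, j)))"
    by (subst sum.swap) (simp add: sum_distrib_left)
  also have "\<dots> = (\<Sum>t<n. (A ^\<^sub>m k) $$ (i, t)) * d"
    by (simp add: row_sum sum_distrib_right)
  finally show ?case using Suc by simp
qed

lemma eigenvalue_degree: "eigenvalue A d"
proof -
  let ?v = "vec n (\<lambda>_. 1) :: real vec"
  have "A *\<^sub>v ?v = d \<cdot>\<^sub>v ?v"
  proof (rule eq_vecI)
    fix i assume "i < dim_vec (d \<cdot>\<^sub>v ?v)"
    then show "(A *\<^sub>v ?v) $ i = (d \<cdot>\<^sub>v ?v) $ i"
      using A row_sum[of i] by (simp add: scalar_prod_def atLeast0LessThan)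
  qed (use A in auto)
  moreover have "?v \<noteq> 0\<^sub>v n"
  proof
    assume "?v = 0\<^sub>v n"
    then have "?v $ 0 = 0\<^sub>v n $ 0" by simp
    then show False using n by simp
  qed
  ultimately show ?thesis unfolding eigenvalue_def eigenvector_def
    using A by (intro exI[of _ ?v]) auto
qed

text \<open>The entries of \<open>(A - (d / n) J) ^ k\<close> for \<open>k > 0\<close>.\<close>

definition deviation :: "nat \<Rightarrow> nat \<Rightarrow> nat \<Rightarrow> real" where
  "deviation k i j = (A ^\<^sub>m k) $$ (i, j) - d ^ k / n"

text \<open>For \<open>k > 0\<close> the entries form the power \<open>M ^ k\<close> of a symmetric
  matrix \<open>M\<close>, so that the squared norm of row \<open>s\<close> is the entry of
  \<open>M ^ (2 * k)\<close> at \<open>(s, s)\<close>. The computation with entries covers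
  \<open>k = 0\<close> too.\<close>

lemma deviation_sum_squares:
  assumes "s < n"
  shows "(\<Sum>t<n. (deviation k s t)\<^sup>2) = deviation (2 * k) s s"
proof -
  define c where "c = d ^ k / n"
  have "(deviation k s t)\<^sup>2 = (A ^\<^sub>m k) $$ (s, t) * (A ^\<^sub>m k) $$ (t, s)
      - 2 * c * (A ^\<^sub>m k) $$ (s, t) + c\<^sup>2" if "t < n" for t
    unfolding deviation_def c_def[symmetric] pow_index_sym[OF that assms]
    by (simp add: power2_eq_square algebra_simps)
  then have "(\<Sum>t<n. (deviation k s t)\<^sup>2) = (\<Sum>t<n. (A ^\<^sub>m k) $$ (s, t) * (A ^\<^sub>m k) $$ (t, s)
      - 2 * c * (A ^\<^sub>m k) $$ (s, t) + c\<^sup>2)"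
    by simp
  also have "\<dots> = (A ^\<^sub>m (k + k)) $$ (s, s) - 2 * c * (\<Sum>t<n. (A ^\<^sub>m k) $$ (s, t)) + n * c\<^sup>2"
    unfolding pow_index_add[OF assms assms] sum_distrib_left
    by (simp add: sum.distrib sum_subtractf)
  \<comment> \<open>The middle term is \<open>- 2 * d ^ (2 * k) / n\<close> and the last one
    \<open>d ^ (2 * k) / n\<close>, which leaves the correction in \<open>deviation\<close>.\<close>
  also have "\<dots> = deviation (2 * k) s s"
    unfolding pow_row_sum[OF assms] deviation_def c_def mult_2 power_add
    using n by (simp add: power2_eq_square field_simps)
  finally show ?thesis .
qed

lemma deviation_diag_nonneg: "s < n \<Longrightarrow> 0 \<le> deviation (2 * k) s s"
  by (metis deviation_sum_squares sum_nonneg zero_le_power2)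

text \<open>The square of a diagonal entry is one of the squares in its row, and these add up to the
  diagonal entry for the doubled exponent. This is iterated \<open>i\<close> times.\<close>

lemma deviation_diag_power_le: "s < n \<Longrightarrow> deviation (2 * k) s s ^ (2 ^ i) \<le> deviation (2 * (k * 2 ^ i)) s s"
proof (induction i)
  case (Suc i)
  let ?D = "deviation (2 * (k * 2 ^ i)) s s"
  have "deviation (2 * k) s s ^ (2 ^ Suc i) = (deviation (2 * k) s s ^ (2 ^ i))\<^sup>2"
    by (simp add: power_mult mult.commute flip: power_mult)
  also have "\<dots> \<le> ?D\<^sup>2"
    using Suc by (intro power_mono) (auto intro!: zero_le_power deviation_diag_nonneg)
  also have "\<dots> \<le> (\<Sum>t<n. (deviation (2 * (k * 2 ^ i)) s t)\<^sup>2)"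
    using Suc.prems by (intro member_le_sum) auto
  also have "\<dots> = deviation (2 * (k * 2 ^ Suc i)) s s"
    using Suc.prems by (simp add: deviation_sum_squares mult_ac)
  finally show ?case .
qed simp

lemma sum_deviation_diag:
  "(\<Sum>s<n. deviation k s s) = (\<Sum>s<n. (A ^\<^sub>m k) $$ (s, s)) - d ^ k"
  using n by (simp add: deviation_def sum_subtractf)

context
  fixes lam :: real and es :: "real list"
  assumes lam: "0 < lam" "lam < d" and es: "eigenvalue_list A es"
    and es_le: "\<forall>i\<in>{1..<n}. \<bar>es ! i\<bar> \<le> lam"
begin

text \<open>The subtracted terms \<open>d ^ (2 * k) / n\<close> add up to \<open>d ^ (2 * k)\<close>
  and cancel the contribution of the eigenvalue \<open>d\<close> to the trace.\<close>

lemma sum_deviation_diag_le: "(\<Sum>s<n. deviation (2 * k) s s) \<le> (real n - 1) * lam ^ (2 * k)"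
proof -
  have "char_poly A = (\<Prod>e\<leftarrow>es. [:- e, 1:])" using es by (simp add: eigenvalue_list_def)
  from trace_pow_mat_eq_sum_eigenvalues[OF A this, of "2 * k"]
  show ?thesis
    using sum_eigenvalues_pow_le[OF A es es_le lam(2) eigenvalue_degree, of k]
    by (simp add: sum_deviation_diag)
qed

text \<open>The trace alone gives only the bound \<open>n * lam ^ (2 * k)\<close>; squaring repeatedly
  removes the factor \<open>n\<close>, which replaces diagonalising \<open>A\<close> orthogonally.\<close>

lemma deviation_diag_le:
  assumes s: "s < n"
  shows "deviation (2 * k) s s \<le> lam ^ (2 * k)"
proof -
  have "(deviation (2 * k) s s / lam ^ (2 * k)) ^ (2 ^ i) \<le> n" for i
  proof -
    let ?K = "k * 2 ^ i"
    have "deviation (2 * k) s s ^ (2 ^ i) \<le> deviation (2 * ?K) s s"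
      by (rule deviation_diag_power_le[OF s])
    \<comment> \<open>One diagonal entry is at most the trace because none is negative.\<close>
    also have "\<dots> \<le> (\<Sum>s<n. deviation (2 * ?K) s s)"
      using s by (intro member_le_sum) (auto intro: deviation_diag_nonneg)
    also have "\<dots> \<le> (real n - 1) * lam ^ (2 * ?K)" by (rule sum_deviation_diag_le)
    also have "\<dots> \<le> n * lam ^ (2 * ?K)" using lam by simp
    also have "lam ^ (2 * ?K) = (lam ^ (2 * k)) ^ (2 ^ i)"
      by (simp add: mult.assoc flip: power_mult)
    finally show ?thesis using lam by (simp add: power_divide divide_le_eq)
  qed
  then have "deviation (2 * k) s s / lam ^ (2 * k) \<le> 1" by (rule le_one_if_powers_bounded)
  then show ?thesis using lam by (simp add: divide_le_eq)
qed

text \<open>As in Chebyshev's inequality: each zero entry deviates by exactly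
  \<open>d ^ k / n\<close> in absolute value, and the squares of a whole row add up to at most
  \<open>lam ^ (2 * k)\<close>.\<close>

lemma card_pow_index_eq_0:
  assumes s: "s < n"
  shows "card {t\<in>{..<n}. (A ^\<^sub>m k) $$ (s, t) = 0} * (d ^ k / n)\<^sup>2 \<le> lam ^ (2 * k)"
proof -
  let ?Z = "{t\<in>{..<n}. (A ^\<^sub>m k) $$ (s, t) = 0}"
  have "card ?Z * (d ^ k / n)\<^sup>2 = (\<Sum>t\<in>?Z. (deviation k s t)\<^sup>2)"
    by (simp add: deviation_def)
  also have "\<dots> \<le> (\<Sum>t<n. (deviation k s t)\<^sup>2)" by (intro sum_mono2) auto
  finally show ?thesis using deviation_sum_squares[OF s] deviation_diag_le[OF s, of k] by simp
qed

end
end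

section \<open>Breadth-first search\<close>

subsection \<open>Balls and spheres\<close>

text \<open>Distances are expressed by relation powers, so that unreachable nodes need no special
  value.\<close>

definition ball :: "'a rel \<Rightarrow> nat \<Rightarrow> 'a \<Rightarrow> 'a set" where
  "ball E k s = {v. \<exists>j\<le>k. (s, v) \<in> E ^^ j}"

definition sphere :: "'a rel \<Rightarrow> nat \<Rightarrow> 'a \<Rightarrow> 'a set" where
  "sphere E k s = {v. (s, v) \<in> E ^^ k \<and> (\<forall>j<k. (s, v) \<notin> E ^^ j)}"

lemma ball_0 [simp]: "ball E 0 s = {s}"
  by (auto simp: ball_def)

lemma sphere_0 [simp]: "sphere E 0 s = {s}"
  by (auto simp: sphere_def)

lemma ball_mono: "k \<le> l \<Longrightarrow> ball E k s \<subseteq> ball E l s"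
  unfolding ball_def by (auto dest: le_trans)

lemma sphere_Suc: "sphere E (Suc k) s = ball E (Suc k) s - ball E k s"
  unfolding ball_def sphere_def by (auto simp: le_Suc_eq less_Suc_eq_le simp del: relpow.simps)

lemma sphere_subset_ball: "sphere E k s \<subseteq> ball E k s"
  unfolding ball_def sphere_def by auto

text \<open>A node first reached in step \<open>k + 1\<close> has a predecessor at distance exactly
  \<open>k\<close>; a nearer predecessor would put the node itself into the smaller ball.\<close>

lemma ball_Suc: "ball E (Suc k) s = ball E k s \<union> E `` sphere E k s"
proof (intro equalityI subsetI)
  fix v assume v: "v \<in> ball E (Suc k) s"
  show "v \<in> ball E k s \<union> E `` sphere E k s"
  proof (cases "v \<in> ball E k s")
    case False
    with v have "(s, v) \<in> E ^^ Suc k"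
      unfolding ball_def by (auto simp: le_Suc_eq simp del: relpow.simps)
    then obtain u where u: "(s, u) \<in> E ^^ k" "(u, v) \<in> E" by auto
    have "(s, u) \<notin> E ^^ j" if "j < k" for j
    proof
      assume "(s, u) \<in> E ^^ j"
      with u have "(s, v) \<in> E ^^ Suc j" by auto
      with False \<open>j < k\<close> show False unfolding ball_def using Suc_leI by blast
    qed
    with u show ?thesis by (auto simp: sphere_def)
  qed simp
next
  fix v assume "v \<in> ball E k s \<union> E `` sphere E k s"
  then show "v \<in> ball E (Suc k) s"
  proof
    assume "v \<in> E `` sphere E k s"
    then have "(s, v) \<in> E ^^ Suc k" by (auto simp: sphere_def)
    then show ?thesis unfolding ball_def by blast
  qed (use ball_mono[of k "Suc k" E s] in auto)
qed

lemma relpow_split: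
  assumes "k \<le> j" "(s, t) \<in> E ^^ j"
  shows "\<exists>x. (s, x) \<in> E ^^ k \<and> (x, t) \<in> E ^^ (j - k)"
proof -
  have "E ^^ j = E ^^ k O E ^^ (j - k)"
    using assms(1) by (simp flip: relpow_add)
  with assms(2) show ?thesis by blast
qed

text \<open>The node after \<open>k\<close> steps of a shortest walk to \<open>t\<close> is at
  distance exactly \<open>k\<close>. So the search does not run out of layers before it reaches
  \<open>t\<close>.\<close>

lemma sphere_nonempty:
  assumes "t \<notin> ball E k s" "(s, t) \<in> E ^^ j"
  shows "sphere E k s \<noteq> {}"
proof -
  define D where "D = (LEAST j. (s, t) \<in> E ^^ j)"
  have D: "(s, t) \<in> E ^^ D" unfolding D_def using assms(2) by (rule LeastI)
  have D_least: "D \<le> i" if "(s, t) \<in> E ^^ i" for i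
    unfolding D_def using that by (rule Least_le)
  have "k \<le> D"
  proof (rule ccontr)
    assume "\<not> k \<le> D"
    then have "D \<le> k" by simp
    with assms(1) D show False unfolding ball_def by blast
  qed
  from relpow_split[OF this D] obtain x where x: "(s, x) \<in> E ^^ k" "(x, t) \<in> E ^^ (D - k)"
    by blast
  \<comment> \<open>A shorter way to \<open>x\<close> would shorten the shortest walk to
    \<open>t\<close>.\<close>
  have "(s, x) \<notin> E ^^ i" if "i < k" for i
  proof
    assume "(s, x) \<in> E ^^ i"
    with x have "(s, t) \<in> E ^^ (i + (D - k))" unfolding relpow_add by blast
    then have "D \<le> i + (D - k)" by (rule D_least)
    with that \<open>k \<le> D\<close> show False by simp
  qed
  with x have "x \<in> sphere E k s" by (simp add: sphere_def)
  then show ?thesis by blast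
qed

lemma sym_relpow: "sym E \<Longrightarrow> (u, v) \<in> E ^^ k \<Longrightarrow> (v, u) \<in> E ^^ k"
proof (induction k arbitrary: u v)
  case (Suc k)
  then obtain w where "(u, w) \<in> E ^^ k" "(w, v) \<in> E" by auto
  with Suc show ?case by (meson relpow_Suc_I2 symD)
qed auto

text \<open>Otherwise the node of the walk after \<open>min j a\<close> steps lies in both balls;
  the minimum covers walks shorter than \<open>a\<close>.\<close>

lemma no_short_walk_if_balls_disjoint:
  assumes E: "sym E" and disj: "ball E a s \<inter> ball E b t = {}" and st: "(s, t) \<in> E ^^ j"
  shows "a + b < j"
proof (rule ccontr)
  assume "\<not> a + b < j"
  then have i: "min j a \<le> j" "min j a \<le> a" "j - min j a \<le> b" by auto
  from relpow_split[OF i(1) st] obtain x where x: "(s, x) \<in> E ^^ min j a" "(x, t) \<in> E ^^ (j - min j a)"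
    by blast
  then have "(t, x) \<in> E ^^ (j - min j a)" using E by (blast intro: sym_relpow)
  with x i have "x \<in> ball E a s \<inter> ball E b t" unfolding ball_def by blast
  with disj show False by blast
qed

subsection \<open>Walks\<close>

lemma relpow_if_vwalk:
  "vwalk p (with_proj G) \<Longrightarrow> (hd p, last p) \<in> parcs G ^^ (length p - 1)"
proof (induction p rule: vwalk_induct)
  case (Cons u v es)
  then have "(u, last (v # es)) \<in> parcs G ^^ Suc (length es)"
    by (intro relpow_Suc_I2) auto
  then show ?case by (simp del: relpow.simps)
qed simp

lemma vwalk_snocI:
  assumes "vwalk p (with_proj G)" "(last p, v) \<in> parcs G" "v \<in> pverts G"
  shows "vwalk (p @ [v]) (with_proj G)"
  using assms by (auto simp: vwalk_def vwalk_arcs_append)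

context pair_sym_digraph
begin

lemma sym_parcs: "sym (parcs G)"
  using arcs_symmetric by (auto intro: symI)

lemma vwalk_if_relpow:
  "(s, v) \<in> parcs G ^^ k \<Longrightarrow> s \<in> pverts G \<Longrightarrow>
    \<exists>p. vwalk p (with_proj G) \<and> hd p = s \<and> last p = v \<and> length p = Suc k"
proof (induction k arbitrary: v)
  case 0
  then show ?case by (intro exI[of _ "[s]"]) (auto intro: vwalkI)
next
  case (Suc k)
  then obtain u where "(s, u) \<in> parcs G ^^ k" "(u, v) \<in> parcs G" by auto
  moreover from Suc.IH[OF this(1) Suc.prems(2)] obtain p where
    "vwalk p (with_proj G)" "hd p = s" "last p = u" "length p = Suc k" by blast
  moreover from this have "p \<noteq> []" by auto
  ultimately show ?case
    by (intro exI[of _ "p @ [v]"]) (auto intro!: vwalk_snocI dest: in_arcsD2)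
qed

text \<open>Replaces the comparison with other walks by relation powers. Since
  \<open>length p\<close> counts nodes, a walk with \<open>k\<close> arcs has length
  \<open>Suc k\<close>.\<close>

lemma shortest_walk_iff:
  assumes "s \<in> pverts G"
  shows "shortest_walk G s t p \<longleftrightarrow> vwalk p (with_proj G) \<and> hd p = s \<and> last p = t \<and>
    (\<forall>k. (s, t) \<in> parcs G ^^ k \<longrightarrow> length p \<le> Suc k)"
proof -
  have "(\<forall>q. vwalk q (with_proj G) \<and> hd q = s \<and> last q = t \<longrightarrow> length p - 1 \<le> length q - 1) \<longleftrightarrow>
    (\<forall>k. (s, t) \<in> parcs G ^^ k \<longrightarrow> length p \<le> Suc k)" (is "?L \<longleftrightarrow> ?R")
  proof
    assume L: ?L
    show ?R
    proof (intro allI impI)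
      fix k assume "(s, t) \<in> parcs G ^^ k"
      from vwalk_if_relpow[OF this assms] L show "length p \<le> Suc k" by fastforce
    qed
  next
    assume R: ?R
    show ?L
    proof (intro allI impI)
      fix q assume "vwalk q (with_proj G) \<and> hd q = s \<and> last q = t"
      with relpow_if_vwalk[of q G] R have "length p \<le> Suc (length q - 1)" by blast
      then show "length p - 1 \<le> length q - 1" by simp
    qed
  qed
  then show ?thesis by (auto simp: shortest_walk_def)
qed

lemma vwalk_rev: "vwalk p (with_proj G) \<Longrightarrow> vwalk (rev p) (with_proj G)"
  by (auto simp: vwalk_def set_vwalk_arcs_rev intro: arcs_symmetric)

text \<open>The two halves have at most \<open>a\<close> and \<open>b\<close> arcs, and no walk from
  \<open>s\<close> to \<open>t\<close> has fewer than \<open>a + b\<close>. Dropping the head of the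
  reversed \<open>q\<close> avoids repeating \<open>v\<close>.\<close>

lemma shortest_walk_join:
  assumes s: "s \<in> pverts G" and t: "t \<in> pverts G"
    and p: "shortest_walk G s v p" "v \<in> ball (parcs G) a s"
    and q: "shortest_walk G t v q" "v \<in> ball (parcs G) b t"
    and far: "\<And>j. (s, t) \<in> parcs G ^^ j \<Longrightarrow> a + b \<le> j"
  shows "shortest_walk G s t (p @ tl (rev q))"
proof -
  have P: "vwalk p (with_proj G)" "hd p = s" "last p = v" "p \<noteq> []" "length p \<le> Suc a"
    using p s by (auto simp: shortest_walk_iff ball_def dest: le_trans)
  have Q: "vwalk q (with_proj G)" "hd q = t" "last q = v" "q \<noteq> []" "length q \<le> Suc b"
    using q t by (auto simp: shortest_walk_iff ball_def dest: le_trans)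
  have "joinable p (rev q)" using P Q by (simp add: hd_rev)
  then have "vwalk (p @ tl (rev q)) (with_proj G)" "hd (p @ tl (rev q)) = s"
    "last (p @ tl (rev q)) = t"
    using vwalk_joinI_vwalk[OF P(1) vwalk_rev[OF Q(1)]] vwalk_join_hd[of p "rev q"]
      vwalk_join_last[of p "rev q"] P Q
    by (auto simp: vwalk_join_def last_rev)
  moreover have "length (p @ tl (rev q)) \<le> Suc j" if "(s, t) \<in> parcs G ^^ j" for j
    using P(5) Q(4,5) far[OF that] by (cases q) auto
  ultimately show ?thesis using s by (simp add: shortest_walk_iff)
qed

subsection \<open>Correctness of the search\<close>

text \<open>The part of the invariant that survives when a scan stops in the middle of a
  layer.\<close>

definition shortest_walk_tree :: "'a \<Rightarrow> 'a bfs_tree \<Rightarrow> bool" where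
  "shortest_walk_tree r T \<longleftrightarrow> (\<forall>v p. T v = Some p \<longrightarrow> shortest_walk G r v p)"

definition full_layers :: "'a \<Rightarrow> nat \<Rightarrow> 'a bfs_tree \<Rightarrow> 'a list \<Rightarrow> bool" where
  "full_layers r k T L \<longleftrightarrow>
     shortest_walk_tree r T \<and> dom T = ball (parcs G) k r \<and> set L = sphere (parcs G) k r"

text \<open>\<open>p\<close> has at most \<open>k\<close> arcs, whereas every walk to
  \<open>v\<close> has more than \<open>k\<close>.\<close>

lemma shortest_walk_snoc:
  assumes r: "r \<in> pverts G" and p: "shortest_walk G r u p" and u: "u \<in> ball (parcs G) k r"
    and uv: "(u, v) \<in> parcs G" and v: "v \<notin> ball (parcs G) k r"
  shows "shortest_walk G r v (p @ [v])"
proof -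
  have P: "vwalk p (with_proj G)" "hd p = r" "last p = u" "p \<noteq> []" "length p \<le> Suc k"
    using p u r by (auto simp: shortest_walk_iff ball_def dest: le_trans)
  moreover have "Suc k \<le> j" if "(r, v) \<in> parcs G ^^ j" for j
    using that v unfolding ball_def by (auto simp: not_le[symmetric] Suc_le_eq)
  ultimately have "\<forall>j. (r, v) \<in> parcs G ^^ j \<longrightarrow> length (p @ [v]) \<le> Suc j"
    by (auto intro: le_trans)
  moreover note P
  ultimately show ?thesis
    using r uv by (auto simp: shortest_walk_iff intro!: vwalk_snocI dest: in_arcsD2)
qed

text \<open>The radius \<open>k\<close> stays fixed while \<open>T\<close> grows, so the invariant
  only asks that \<open>T\<close> contain the ball. An undiscovered \<open>v\<close> then lies
  outside the ball, and extending the path of a sphere node by \<open>v\<close> is optimal.\<close>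

lemma scan_correct:
  assumes r: "r \<in> pverts G"
  shows "scan Oth es T L = (T', L', m) \<Longrightarrow> shortest_walk_tree r T \<Longrightarrow>
    ball (parcs G) k r \<subseteq> dom T \<Longrightarrow>
    (\<forall>(u, v)\<in>set es. u \<in> sphere (parcs G) k r \<and> (u, v) \<in> parcs G) \<Longrightarrow>
    shortest_walk_tree r T' \<and> dom T' \<subseteq> dom T \<union> snd ` set es \<and>
    (m = None \<longrightarrow> dom T' = dom T \<union> snd ` set es \<and> set L' = set L \<union> (snd ` set es - dom T) \<and>
       (dom T' - dom T) \<inter> dom Oth = {}) \<and>
    (\<forall>w. m = Some w \<longrightarrow> w \<in> dom T' \<inter> dom Oth)"
proof (induction Oth es T L arbitrary: T' L' m rule: scan.induct)
  case (1 Oth T L)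
  then show ?case by auto
next
  case (2 Oth u v es T L)
  show ?case
  proof (cases "v \<in> dom T")
    case True
    then have "scan Oth es T L = (T', L', m)" using "2.prems"(1) by auto
    note IH = "2.IH"(1)[OF True this "2.prems"(2,3)]
    have eqs: "dom T \<union> snd ` set ((u, v) # es) = dom T \<union> snd ` set es"
      "snd ` set ((u, v) # es) - dom T = snd ` set es - dom T"
      using True by auto
    show ?thesis unfolding eqs by (rule IH) (use "2.prems"(4) in auto)
  next
    case False
    define T1 where "T1 = T(v \<mapsto> the (T u) @ [v])"
    have u: "u \<in> sphere (parcs G) k r" "(u, v) \<in> parcs G" using "2.prems"(4) by auto
    \<comment> \<open>This makes \<open>the (T u)\<close> a stored path rather than an unspecified
      value.\<close>
    then have "u \<in> dom T" using "2.prems"(3) sphere_subset_ball by fastforce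
    then have "shortest_walk G r u (the (T u))"
      using "2.prems"(2) by (auto simp: shortest_walk_tree_def)
    with u False "2.prems"(3) have "shortest_walk G r v (the (T u) @ [v])"
      using r shortest_walk_snoc sphere_subset_ball by (metis subsetD)
    then have T1: "shortest_walk_tree r T1" "dom T1 = insert v (dom T)"
      using "2.prems"(2) by (auto simp: shortest_walk_tree_def T1_def)
    show ?thesis
    proof (cases "v \<in> dom Oth")
      case True
      then have "T' = T1" "m = Some v" using "2.prems"(1) False by (auto simp: T1_def Let_def)
      then show ?thesis using T1 True by auto
    next
      case nOth: False
      have sc: "scan Oth es T1 (L @ [v]) = (T', L', m)"
        using "2.prems"(1) False nOth unfolding scan.simps Let_def T1_def by (simp only: if_False)
      have step: "shortest_walk_tree r T' \<and> dom T' \<subseteq> dom T1 \<union> snd ` set es \<and>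
        (m = None \<longrightarrow> dom T' = dom T1 \<union> snd ` set es \<and>
           set L' = set (L @ [v]) \<union> (snd ` set es - dom T1) \<and>
           (dom T' - dom T1) \<inter> dom Oth = {}) \<and>
        (\<forall>w. m = Some w \<longrightarrow> w \<in> dom T' \<inter> dom Oth)"
        by (rule "2.IH"(2)[OF False T1_def refl nOth sc T1(1)]) (use "2.prems"(3,4) T1(2) in auto)
      have eqs: "dom T \<union> snd ` set ((u, v) # es) = dom T1 \<union> snd ` set es"
        "set L \<union> (snd ` set ((u, v) # es) - dom T) = set (L @ [v]) \<union> (snd ` set es - dom T1)"
        "(dom T' - dom T) \<inter> dom Oth = (dom T' - dom T1) \<inter> dom Oth"
        unfolding T1(2) using False nOth by auto
      show ?thesis unfolding eqs by (rule step)
    qed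
  qed
qed

text \<open>The scanned pairs are exactly the arcs leaving the sphere of radius \<open>k\<close>, so
  their targets extend the ball to radius \<open>k + 1\<close>. After an early stop only the
  inclusion remains.\<close>

lemma grow_layer_correct:
  assumes r: "r \<in> pverts G" and nbrs: "adjacency_lists G nbrs" and T: "full_layers r k T L"
    and grow: "grow_layer nbrs Oth T L = (T', L', m)"
  shows "shortest_walk_tree r T'" "dom T' \<subseteq> ball (parcs G) (Suc k) r"
    "m = None \<Longrightarrow> full_layers r (Suc k) T' L'"
    "m = None \<Longrightarrow> dom T \<inter> dom Oth = {} \<Longrightarrow> dom T' \<inter> dom Oth = {}"
    "m = Some v \<Longrightarrow> v \<in> dom T' \<and> v \<in> dom Oth"
proof -
  let ?es = "[(u, v). u \<leftarrow> L, v \<leftarrow> nbrs u]"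
  let ?E = "parcs G"
  have T': "shortest_walk_tree r T" "dom T = ball ?E k r" "set L = sphere ?E k r"
    using T by (auto simp: full_layers_def)
  have "x \<in> pverts G" if "(r, x) \<in> ?E ^^ j" for j x
    using that r by (cases j) (auto dest: in_arcsD2)
  \<comment> \<open>Adjacency lists are specified only for nodes of the graph.\<close>
  then have "sphere ?E k r \<subseteq> pverts G" unfolding sphere_def by blast
  then have es: "set ?es = {(u, v). u \<in> sphere ?E k r \<and> (u, v) \<in> ?E}"
    using nbrs T'(3) by (force simp: adjacency_lists_def)
  then have img: "snd ` set ?es = ?E `` sphere ?E k r" by (auto simp: image_iff)
  have sc: "scan Oth ?es T [] = (T', L', m)" using grow by (simp add: grow_layer_def)
  have "ball ?E k r \<subseteq> dom T" "\<forall>(u, v)\<in>set ?es. u \<in> sphere ?E k r \<and> (u, v) \<in> ?E"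
    unfolding es T'(2) by auto
  note S = scan_correct[OF r sc T'(1) this]
  show "shortest_walk_tree r T'" using S by blast
  show "dom T' \<subseteq> ball ?E (Suc k) r" using S T'(2) unfolding img ball_Suc by blast
  show "full_layers r (Suc k) T' L'" if "m = None"
    using S that T'(2) unfolding img full_layers_def sphere_Suc ball_Suc by auto
  show "dom T' \<inter> dom Oth = {}" if "m = None" "dom T \<inter> dom Oth = {}"
    using S that by blast
  show "v \<in> dom T' \<and> v \<in> dom Oth" if "m = Some v" using S that by blast
qed

section \<open>The loop of the bidirectional search\<close>

context
  fixes s t :: 'a and nbrs :: "'a \<Rightarrow> 'a list"
  assumes s: "s \<in> pverts G" and t: "t \<in> pverts G" and nbrs: "adjacency_lists G nbrs"
begin

definition searching :: "nat \<Rightarrow> 'a bibfs_state \<Rightarrow> bool" where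
  "searching k \<sigma> \<longleftrightarrow> meet \<sigma> = None \<and> full_layers s k (tree_s \<sigma>) (layer_s \<sigma>) \<and>
     full_layers t k (tree_t \<sigma>) (layer_t \<sigma>) \<and> dom (tree_s \<sigma>) \<inter> dom (tree_t \<sigma>) = {}"

text \<open>One radius serves both sides, although the tree of \<open>t\<close> is a layer behind if
  the search stops while the tree of \<open>s\<close> grows.\<close>

definition found :: "nat \<Rightarrow> 'a bibfs_state \<Rightarrow> bool" where
  "found k \<sigma> \<longleftrightarrow> meet \<sigma> \<noteq> None \<and> (\<exists>p. bibfs_path \<sigma> = Some p \<and> shortest_walk G s t p) \<and>
     visited \<sigma> \<subseteq> ball (parcs G) k s \<union> ball (parcs G) k t"

text \<open>The radii \<open>a\<close> and \<open>b\<close> are kept apart because a meeting may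
  occur while only the first tree has grown. Assumption \<open>far\<close> is what places the common
  node on a shortest walk.\<close>

lemma foundI:
  assumes "meet \<sigma> = Some v" and Ts: "shortest_walk_tree s (tree_s \<sigma>)"
    and Tt: "shortest_walk_tree t (tree_t \<sigma>)"
    and v: "v \<in> dom (tree_s \<sigma>)" "v \<in> dom (tree_t \<sigma>)"
    and sub: "dom (tree_s \<sigma>) \<subseteq> ball (parcs G) a s" "dom (tree_t \<sigma>) \<subseteq> ball (parcs G) b t"
    and le: "a \<le> k" "b \<le> k"
    and far: "\<And>j. (s, t) \<in> parcs G ^^ j \<Longrightarrow> a + b \<le> j"
  shows "found k \<sigma>"
proof -
  have "shortest_walk G s v (the (tree_s \<sigma> v))" "shortest_walk G t v (the (tree_t \<sigma> v))"
    using v Ts Tt by (auto simp: shortest_walk_tree_def)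
  from shortest_walk_join[OF s t this(1) _ this(2) _ far] v sub
  have "shortest_walk G s t (the (tree_s \<sigma> v) @ tl (rev (the (tree_t \<sigma> v))))" by blast
  then show ?thesis using assms ball_mono[OF le(1)] ball_mono[OF le(2)]
    unfolding found_def bibfs_path_def visited_def by fastforce
qed

text \<open>Before either tree grows, the two balls are disjoint, so the distance of
  \<open>s\<close> and \<open>t\<close> exceeds the sum of the radii. It is therefore at least the
  sum after one more layer, and any meeting node in that layer is on a shortest walk.\<close>

lemma bibfs_step_correct:
  assumes "searching k \<sigma>"
  shows "searching (Suc k) (bibfs_step nbrs \<sigma>) \<or> found (Suc k) (bibfs_step nbrs \<sigma>)"
proof -
  let ?E = "parcs G"
  have Ts: "full_layers s k (tree_s \<sigma>) (layer_s \<sigma>)" and Tt: "full_layers t k (tree_t \<sigma>) (layer_t \<sigma>)"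
    and disj: "dom (tree_s \<sigma>) \<inter> dom (tree_t \<sigma>) = {}"
    using assms by (auto simp: searching_def)
  have domt: "dom (tree_t \<sigma>) = ball ?E k t" "shortest_walk_tree t (tree_t \<sigma>)"
    using Tt by (auto simp: full_layers_def)
  have doms: "dom (tree_s \<sigma>) = ball ?E k s" using Ts by (auto simp: full_layers_def)
  obtain S LS m where g1: "grow_layer nbrs (tree_t \<sigma>) (tree_s \<sigma>) (layer_s \<sigma>) = (S, LS, m)"
    by (metis prod_cases3)
  note G1 = grow_layer_correct[OF s nbrs Ts g1]
  show ?thesis
  proof (cases m)
    case (Some v)
    have "found (Suc k) (bibfs_step nbrs \<sigma>)"
    proof (rule foundI[where v = v and a = "Suc k" and b = k])
      show "Suc k + k \<le> j" if "(s, t) \<in> ?E ^^ j" for j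
        using no_short_walk_if_balls_disjoint[OF sym_parcs _ that, of k k] disj doms domt by simp
    qed (use G1(1,2) G1(5)[OF Some] domt in \<open>auto simp: bibfs_step_def g1 Some\<close>)
    then show ?thesis ..
  next
    case None
    obtain T LT m' where g2: "grow_layer nbrs S (tree_t \<sigma>) (layer_t \<sigma>) = (T, LT, m')"
      by (metis prod_cases3)
    note G2 = grow_layer_correct[OF t nbrs Tt g2]
    have step: "bibfs_step nbrs \<sigma> =
      \<lparr>tree_s = S, layer_s = LS, tree_t = T, layer_t = LT, meet = m'\<rparr>"
      by (simp add: bibfs_step_def g1 g2 None)
    note S = G1(3)[OF None] G1(4)[OF None disj]
    have domS: "dom S = ball ?E (Suc k) s" "shortest_walk_tree s S"
      using S(1) by (auto simp: full_layers_def)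
    show ?thesis
    proof (cases m')
      case None
      then have "searching (Suc k) (bibfs_step nbrs \<sigma>)"
        using S G2(3)[OF None] G2(4)[OF None] by (auto simp: searching_def step)
      then show ?thesis ..
    next
      case (Some v)
      have "found (Suc k) (bibfs_step nbrs \<sigma>)"
      proof (rule foundI[where v = v and a = "Suc k" and b = "Suc k"])
        \<comment> \<open>The first half of the iteration left balls of radii \<open>k + 1\<close>
          and \<open>k\<close> disjoint.\<close>
        show "Suc k + Suc k \<le> j" if "(s, t) \<in> ?E ^^ j" for j
          using no_short_walk_if_balls_disjoint[OF sym_parcs _ that, of "Suc k" k] S(2) domS domt
          by simp
      qed (use G2(1,2) G2(5)[OF Some] domS in \<open>auto simp: step Some\<close>)
      then show ?thesis ..
    qed
  qed
qed

text \<open>If the search still runs after \<open>k\<close> iterations, the balls of radius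
  \<open>k\<close> are disjoint, so \<open>2 * k < j \<le> 2 * m\<close> and the next iteration
  stays within radius \<open>m\<close>. Hence \<open>m - k\<close> serves as termination
  measure.\<close>

lemma bibfs_correct:
  assumes st: "(s, t) \<in> parcs G ^^ j" and j: "j \<le> 2 * m"
  shows "\<exists>\<sigma>. bibfs nbrs s t = Some \<sigma> \<and> found m \<sigma>"
proof -
  let ?W = "while_option (\<lambda>\<sigma>. meet \<sigma> = None \<and> layer_s \<sigma> \<noteq> [] \<and> layer_t \<sigma> \<noteq> []) (bibfs_step nbrs)"
  have run_found: "?W \<sigma> = Some \<sigma>" if "found k \<sigma>" for k \<sigma>
    using that by (subst while_option_unfold) (auto simp: found_def)
  have found_mono: "found m \<sigma>" if "found k \<sigma>" "k \<le> m" for k \<sigma>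
    using that ball_mono[OF that(2), of "parcs G"] unfolding found_def by blast
  have run: "\<exists>\<sigma>'. ?W \<sigma> = Some \<sigma>' \<and> found m \<sigma>'" if "searching k \<sigma>" for k \<sigma>
    using that
  proof (induction "m - k" arbitrary: k \<sigma> rule: less_induct)
    case less
    have Ts: "dom (tree_s \<sigma>) = ball (parcs G) k s" "set (layer_s \<sigma>) = sphere (parcs G) k s"
      and Tt: "dom (tree_t \<sigma>) = ball (parcs G) k t" "set (layer_t \<sigma>) = sphere (parcs G) k t"
      and disj: "dom (tree_s \<sigma>) \<inter> dom (tree_t \<sigma>) = {}"
      using less.prems by (auto simp: searching_def full_layers_def)
    have "k + k < j"
      using no_short_walk_if_balls_disjoint[OF sym_parcs _ st] disj Ts Tt by simp
    then have "k < m" using j by simp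
    have "s \<in> ball (parcs G) k s" "t \<in> ball (parcs G) k t"
      by (auto simp: ball_def intro!: exI[of _ 0])
    then have "t \<notin> ball (parcs G) k s" "s \<notin> ball (parcs G) k t" using disj Ts Tt by auto
    \<comment> \<open>The loop cannot end with an empty layer: a walk joins \<open>s\<close> and
      \<open>t\<close>, and neither lies in the ball around the other.\<close>
    with sphere_nonempty st sym_relpow[OF sym_parcs st]
    have "layer_s \<sigma> \<noteq> []" "layer_t \<sigma> \<noteq> []" using Ts(2) Tt(2) by fastforce+
    moreover have "meet \<sigma> = None" using less.prems by (simp add: searching_def)
    ultimately have W: "?W \<sigma> = ?W (bibfs_step nbrs \<sigma>)"
      by (subst while_option_unfold) simp
    from bibfs_step_correct[OF less.prems] show ?case
    proof
      assume "searching (Suc k) (bibfs_step nbrs \<sigma>)"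
      with less.hyps[of "Suc k"] \<open>k < m\<close> show ?thesis by (simp add: W)
    next
      assume f: "found (Suc k) (bibfs_step nbrs \<sigma>)"
      with found_mono[OF f] run_found[OF f] \<open>k < m\<close> show ?thesis by (simp add: W)
    qed
  qed
  have init: "shortest_walk_tree r [r \<mapsto> [r]]" if "r \<in> pverts G" for r
    using that by (auto simp: shortest_walk_tree_def shortest_walk_iff)
  show ?thesis
  proof (cases "s = t")
    case True
    have "found 0 (bibfs_init s t)"
      by (rule foundI[where v = s and a = 0 and b = 0])
        (use True init s in \<open>auto simp: bibfs_init_def\<close>)
    with run_found found_mono show ?thesis unfolding bibfs_def by blast
  next
    case False
    have "searching 0 (bibfs_init s t)"
      using False init s t by (auto simp: searching_def full_layers_def bibfs_init_def)
    with run show ?thesis unfolding bibfs_def by blast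
  qed
qed

end

lemma bibfs_finds_shortest_withinI:
  assumes "s \<in> pverts G" "t \<in> pverts G" "(s, t) \<in> parcs G ^^ j" "j \<le> 2 * m"
    and fin: "finite (ball (parcs G) m s)" "finite (ball (parcs G) m t)"
    and b: "real (card (ball (parcs G) m s)) + real (card (ball (parcs G) m t)) \<le> b"
  shows "bibfs_finds_shortest_within G s t b"
  unfolding bibfs_finds_shortest_within_def
proof (intro allI impI)
  fix nbrs assume nbrs: "adjacency_lists G nbrs"
  from bibfs_correct[OF assms(1,2) nbrs assms(3,4)] obtain \<sigma> p where
    \<sigma>: "bibfs nbrs s t = Some \<sigma>" "bibfs_path \<sigma> = Some p" "shortest_walk G s t p"
      "visited \<sigma> \<subseteq> ball (parcs G) m s \<union> ball (parcs G) m t"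
    using found_def[OF assms(1,2) nbrs] by blast
  have "card (visited \<sigma>) \<le> card (ball (parcs G) m s) + card (ball (parcs G) m t)"
    using card_mono[OF _ \<sigma>(4)] fin card_Un_le by (metis finite_UnI le_trans)
  with b \<sigma> show "\<exists>\<sigma> p. bibfs nbrs s t = Some \<sigma> \<and> bibfs_path \<sigma> = Some p \<and>
    shortest_walk G s t p \<and> real (card (visited \<sigma>)) \<le> b"
    by (intro exI[of _ \<sigma>] exI[of _ p]) auto
qed

end

subsection \<open>Growth of balls\<close>

context
  fixes E :: "'a rel" and d :: nat
  assumes E: "sym E" and fin: "\<And>v. finite (E `` {v})" and deg: "\<And>v. card (E `` {v}) \<le> d"
begin

lemma finite_ball: "finite (ball E k s)"
proof (induction k)
  case (Suc k)
  have "E `` sphere E k s = (\<Union>v\<in>sphere E k s. E `` {v})" by auto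
  then have "finite (E `` sphere E k s)"
    using finite_subset[OF sphere_subset_ball Suc] fin by simp
  with Suc show ?case by (simp add: ball_Suc)
qed simp

lemma finite_sphere: "finite (sphere E k s)"
  using finite_subset[OF sphere_subset_ball finite_ball] .

text \<open>By symmetry a node in layer \<open>k + 1\<close> has a neighbour in layer
  \<open>k\<close>, which leaves at most \<open>d - 1\<close> neighbours for layer
  \<open>k + 2\<close>.\<close>

lemma card_sphere_Suc_Suc: "card (sphere E (Suc (Suc k)) s) \<le> card (sphere E (Suc k) s) * (d - 1)"
proof -
  let ?S = "sphere E (Suc k) s"
  have sub: "sphere E (Suc (Suc k)) s \<subseteq> (\<Union>u\<in>?S. E `` {u} - ball E k s)"
    using ball_mono[of k "Suc k" E s] by (auto simp: sphere_Suc[of E "Suc k"] ball_Suc[of E "Suc k"])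
  have "card (E `` {u} - ball E k s) \<le> d - 1" if u: "u \<in> ?S" for u
  proof -
    have "u \<in> E `` sphere E k s" using u by (auto simp: sphere_Suc ball_Suc)
    then obtain w where "w \<in> sphere E k s" "(w, u) \<in> E" by blast
    then have w: "w \<in> ball E k s" "w \<in> E `` {u}"
      using E sphere_subset_ball[of E k s] by (auto dest: symD)
    then have "card (E `` {u} - ball E k s) \<le> card (E `` {u} - {w})"
      using fin by (intro card_mono) auto
    also have "\<dots> \<le> d - 1" using w fin deg[of u] by (simp add: card_Diff_singleton diff_le_mono)
    finally show ?thesis .
  qed
  then have "(\<Sum>u\<in>?S. card (E `` {u} - ball E k s)) \<le> (\<Sum>u\<in>?S. d - 1)" by (rule sum_mono)
  moreover have "card (\<Union>u\<in>?S. E `` {u} - ball E k s) \<le> (\<Sum>u\<in>?S. card (E `` {u} - ball E k s))"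
    by (rule card_UN_le[OF finite_sphere])
  moreover have "card (sphere E (Suc (Suc k)) s) \<le> card (\<Union>u\<in>?S. E `` {u} - ball E k s)"
    using sub finite_sphere fin by (intro card_mono) auto
  ultimately show ?thesis by simp
qed

lemma card_sphere_Suc: "card (sphere E (Suc k) s) \<le> d * (d - 1) ^ k"
proof (induction k)
  case 0
  have "sphere E (Suc 0) s \<subseteq> E `` {s}" by (auto simp: sphere_Suc ball_Suc)
  from card_mono[OF fin this] deg[of s] show ?case by simp
next
  case (Suc k)
  note card_sphere_Suc_Suc
  also have "card (sphere E (Suc k) s) * (d - 1) \<le> d * (d - 1) ^ k * (d - 1)"
    using Suc by (rule mult_le_mono1)
  finally show ?case by (simp add: mult_ac)
qed

lemma card_ball_le:
  assumes d: "3 \<le> d"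
  shows "card (ball E k s) \<le> 3 * (d - 1) ^ k"
proof (induction k)
  case (Suc k)
  have "card (ball E (Suc k) s) = card (ball E k s \<union> sphere E (Suc k) s)"
    using ball_mono[of k "Suc k" E s] by (simp add: sphere_Suc Un_absorb1)
  also have "\<dots> \<le> card (ball E k s) + card (sphere E (Suc k) s)" by (rule card_Un_le)
  also have "\<dots> \<le> 3 * (d - 1) ^ k + d * (d - 1) ^ k" using Suc card_sphere_Suc by (rule add_mono)
  also have "\<dots> = (3 + d) * (d - 1) ^ k" by (simp add: algebra_simps)
  \<comment> \<open>\<open>3 + d \<le> 3 * (d - 1)\<close> amounts to \<open>d \<ge> 3\<close>; at
    \<open>d = 3\<close> no factor smaller than 3 would pass this step.\<close>
  also have "\<dots> \<le> 3 * (d - 1) * (d - 1) ^ k" using d by (intro mult_right_mono) auto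
  finally show ?case by simp
qed simp

end

section \<open>Graphs with bounded second eigenvalue\<close>

lemma card_out_neighbours:
  "out_degree (with_proj G) v = card (parcs G `` {v})"
proof -
  have "out_arcs (with_proj G) v = Pair v ` (parcs G `` {v})"
    by (auto simp: out_arcs_def)
  then show ?thesis by (simp add: out_degree_def card_image inj_on_def)
qed

locale ndl =
  fixes n d :: nat and lam :: real and G :: "nat pair_pre_digraph"
  assumes ndl: "ndl_graph n d lam G" and lam: "0 < lam" "lam < real d"
    and nonempty: "0 < n"
begin

sublocale pair_graph G
  using ndl by (simp add: ndl_graph_def)

lemma verts: "pverts G = {..<n}"
  using ndl by (simp add: ndl_graph_def)

lemma neighbours_subset: "parcs G `` {v} \<subseteq> {..<n}"
  using in_arcsD2 verts by auto

lemma finite_neighbours: "finite (parcs G `` {v})"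
  using finite_subset[OF neighbours_subset] by simp

lemma degree: "v < n \<Longrightarrow> card (parcs G `` {v}) = d"
  using ndl verts by (simp add: ndl_graph_def card_out_neighbours)

lemma degree_le: "card (parcs G `` {v}) \<le> d"
proof (cases "v < n")
  case False
  then have "parcs G `` {v} = {}" using in_arcsD1 verts by auto
  then show ?thesis by simp
qed (simp add: degree)

abbreviation "Adj \<equiv> adjacency_matrix n G"

lemma row_sum: "i < n \<Longrightarrow> (\<Sum>j<n. Adj $$ (i, j)) = d"
proof -
  assume i: "i < n"
  have "(\<Sum>j<n. Adj $$ (i, j)) = (\<Sum>j<n. if j \<in> parcs G `` {i} then 1 else 0)"
    using i by (intro sum.cong) (auto simp: adjacency_matrix_def)
  also have "\<dots> = real (card ({..<n} \<inter> parcs G `` {i}))"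
    by (subst sum.inter_restrict[symmetric]) simp_all
  also have "{..<n} \<inter> parcs G `` {i} = parcs G `` {i}"
    using neighbours_subset by blast
  finally show ?thesis using degree[OF i] by simp
qed

sublocale regular_symmetric_matrix n Adj "real d"
proof
  show "Adj \<in> carrier_mat n n" by (simp add: adjacency_matrix_def)
  show "transpose_mat Adj = Adj"
    by (rule eq_matI) (auto simp: adjacency_matrix_def dest: arcs_symmetric)
qed (use row_sum nonempty in auto)

lemma spectrum_bound:
  obtains es where "eigenvalue_list Adj es" "\<forall>i\<in>{1..<n}. \<bar>es ! i\<bar> \<le> lam"
  using ndl by (auto simp: ndl_graph_def)

text \<open>A nonzero sum has a nonzero summand, which supplies the last arc of a walk.\<close>

lemma relpow_if_pow_index_neq_0:
  "i < n \<Longrightarrow> j < n \<Longrightarrow> (Adj ^\<^sub>m k) $$ (i, j) \<noteq> 0 \<Longrightarrow> (i, j) \<in> parcs G ^^ k"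
proof (induction k arbitrary: j)
  case 0
  then show ?case using A by (auto split: if_splits)
next
  case (Suc k)
  have "(Adj ^\<^sub>m Suc k) $$ (i, j) = (\<Sum>t<n. (Adj ^\<^sub>m k) $$ (i, t) * Adj $$ (t, j))"
    using index_mult_mat_sum[OF pow_carrier A] Suc.prems by simp
  with Suc.prems(3) obtain t where t: "t < n" "(Adj ^\<^sub>m k) $$ (i, t) * Adj $$ (t, j) \<noteq> 0"
    by (metis (no_types, lifting) lessThan_iff sum.neutral)
  then have "(t, j) \<in> parcs G" using Suc.prems by (auto simp: adjacency_matrix_def split: if_splits)
  with t Suc show ?case by auto
qed

text \<open>For \<open>d = 1\<close> the graph is a perfect matching, which has the eigenvalue \<open>-1\<close> besides \<open>1\<close>
  and so violates \<open>lam < d\<close>; the trace of the square of the adjacency matrix detects this.\<close>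

lemma degree_neq_1: "d \<noteq> 1"
proof
  assume d: "d = 1"
  obtain v where "parcs G `` {0} = {v}"
    using degree[OF nonempty] d by (auto simp: card_1_singleton_iff)
  then have "(0, v) \<in> parcs G" by blast
  \<comment> \<open>Without loops the neighbour of \<open>0\<close> is a second node, so that
    \<open>n - 1\<close> is positive below.\<close>
  then have "0 \<noteq> v" "v < n" using no_loops' in_arcsD2 verts by auto
  then have n2: "2 \<le> n" by simp
  have "(Adj ^\<^sub>m (1 + 1)) $$ (s, s) = 1" if s: "s < n" for s
  proof -
    have A1: "Adj ^\<^sub>m 1 = Adj" using A by simp
    have "(Adj ^\<^sub>m (1 + 1)) $$ (s, s) = (\<Sum>t<n. Adj $$ (s, t) * Adj $$ (t, s))"
      using pow_index_add[OF s s, of 1 1] unfolding A1 .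
    also have "\<dots> = (\<Sum>t<n. Adj $$ (s, t))"
      using s by (intro sum.cong) (auto simp: adjacency_matrix_def dest: arcs_symmetric)
    finally show ?thesis using row_sum[OF s] d by simp
  qed
  then have "(\<Sum>s<n. (Adj ^\<^sub>m (2 * 1)) $$ (s, s)) = n" by (simp add: numeral_2_eq_2)
  moreover obtain es where "eigenvalue_list Adj es" "\<forall>i\<in>{1..<n}. \<bar>es ! i\<bar> \<le> lam"
    by (rule spectrum_bound)
  note sum_deviation_diag_le[OF lam this, of 1, unfolded sum_deviation_diag]
  \<comment> \<open>The trace \<open>n\<close> less the term \<open>d ^ 2 = 1\<close> is what the
    other eigenvalues contribute, each at most \<open>lam ^ 2\<close>.\<close>
  ultimately have "real n - 1 \<le> (real n - 1) * lam\<^sup>2"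
    using d by simp
  moreover have "lam\<^sup>2 < 1" using lam d by (simp add: abs_square_less_1)
  ultimately show False using n2 by (simp add: mult_le_cancel_left1)
qed

section \<open>From walk counts to the number of visited nodes\<close>

text \<open>The hypothesis on \<open>k\<close> says
  \<open>(lam / d) ^ (2 * k) \<le> \<delta> / n\<close>; inserted into the bound on the number of
  zero entries, it gives \<open>n ^ 2 * (\<delta> / n)\<close>.\<close>

lemma card_far_le:
  fixes \<delta> :: real
  assumes s: "s < n" and \<delta>: "0 < \<delta>" "\<delta> < 1"
    and k: "log (real d / lam) (real n / \<delta>) \<le> 2 * real k"
  shows "card {t\<in>{..<n}. (s, t) \<notin> parcs G ^^ k} \<le> \<delta> * n"
proof -
  have q: "1 < real d / lam" using lam by simp
  then have "real n / \<delta> \<le> (real d / lam) powr (2 * real k)"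
    using k nonempty \<delta> by (subst (asm) log_le_iff) auto
  also have "\<dots> = (real d / lam) ^ (2 * k)"
    using q by (subst powr_realpow[symmetric]) auto
  finally have nd: "real n / \<delta> * lam ^ (2 * k) \<le> real d ^ (2 * k)"
    using lam by (simp add: power_divide field_simps)
  have pos: "0 < lam ^ (2 * k)" using lam by simp
  let ?Z = "{t\<in>{..<n}. (Adj ^\<^sub>m k) $$ (s, t) = 0}"
  obtain es where es: "eigenvalue_list Adj es" "\<forall>i\<in>{1..<n}. \<bar>es ! i\<bar> \<le> lam"
    by (rule spectrum_bound)
  have "card ?Z * (real d ^ k / n)\<^sup>2 \<le> lam ^ (2 * k)"
    by (rule card_pow_index_eq_0[OF lam es s])
  then have Z: "card ?Z * real d ^ (2 * k) \<le> lam ^ (2 * k) * (real n)\<^sup>2"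
    using nonempty by (simp add: power_divide field_simps flip: power_mult)
  have "card ?Z * (real n / \<delta> * lam ^ (2 * k)) \<le> card ?Z * real d ^ (2 * k)"
    using nd by (rule mult_left_mono) simp
  also note Z
  finally have "(card ?Z * (real n / \<delta>)) * lam ^ (2 * k) \<le> (real n)\<^sup>2 * lam ^ (2 * k)"
    by (simp add: mult_ac)
  then have "card ?Z * (real n / \<delta>) \<le> (real n)\<^sup>2" using pos by (rule mult_right_le_imp_le)
  then have "real (card ?Z) \<le> \<delta> * n"
    using nonempty \<delta> by (simp add: field_simps power2_eq_square)
  moreover have "card {t\<in>{..<n}. (s, t) \<notin> parcs G ^^ k} \<le> card ?Z"
    using relpow_if_pow_index_neq_0[OF s] by (intro card_mono) auto
  ultimately show ?thesis by linarith
qed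

lemma bibfs_bound:
  fixes \<delta> :: real
  assumes d2: "d \<noteq> 2" and s: "s \<in> pverts G" and \<delta>: "0 < \<delta>" "\<delta> < 1"
  shows "(1 - \<delta>) * real n \<le>
    real (card {t \<in> pverts G. bibfs_finds_shortest_within G s t
      (6 * (real d - 1) powi \<lceil>1 / 4 * log (real d / lam) (real n / \<delta>)\<rceil>)})"
proof -
  have d: "3 \<le> d" using d2 degree_neq_1 lam by (cases "d = 0") auto
  have "1 < real d / lam" using lam by simp
  moreover have "1 \<le> real n / \<delta>" using nonempty \<delta> by (simp add: le_divide_eq)
  \<comment> \<open>Nonnegativity makes the ceiling a natural number, so that \<open>powi\<close>
    becomes an ordinary power.\<close>
  ultimately have L: "0 \<le> log (real d / lam) (real n / \<delta>)" by simp
  define m where "m = nat \<lceil>1 / 4 * log (real d / lam) (real n / \<delta>)\<rceil>"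
  have m: "\<lceil>1 / 4 * log (real d / lam) (real n / \<delta>)\<rceil> = int m"
    using L unfolding m_def by (intro nat_0_le[symmetric]) linarith
  then have "1 / 4 * log (real d / lam) (real n / \<delta>) \<le> real m" by linarith
  \<comment> \<open>Walks have length \<open>2 * m\<close>, and squared norms double the exponent
    again: this is the origin of the quarter.\<close>
  then have log_le: "log (real d / lam) (real n / \<delta>) \<le> 2 * real (2 * m)" by simp
  \<comment> \<open>Two balls with at most \<open>3 * (d - 1) ^ m\<close> nodes each.\<close>
  let ?b = "6 * (real d - 1) ^ m"
  let ?far = "{t\<in>{..<n}. (s, t) \<notin> parcs G ^^ (2 * m)}"
  have card_le: "real (card (ball (parcs G) m v)) \<le> 3 * (real d - 1) ^ m" for v
  proof -
    have "card (ball (parcs G) m v) \<le> 3 * (d - 1) ^ m"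
      by (rule card_ball_le[OF sym_parcs finite_neighbours degree_le d])
    then have "real (card (ball (parcs G) m v)) \<le> real (3 * (d - 1) ^ m)"
      by (rule of_nat_mono)
    then show ?thesis using d by (simp add: of_nat_diff)
  qed
  have "{..<n} - ?far \<subseteq> {t \<in> pverts G. bibfs_finds_shortest_within G s t ?b}"
  proof
    fix t assume t: "t \<in> {..<n} - ?far"
    then have tG: "t \<in> pverts G" and st: "(s, t) \<in> parcs G ^^ (2 * m)" using verts by auto
    have fin: "finite (ball (parcs G) m v)" for v
      by (rule finite_ball[OF sym_parcs finite_neighbours degree_le])
    have "bibfs_finds_shortest_within G s t ?b"
      by (rule bibfs_finds_shortest_withinI[OF s tG st order.refl fin fin])
        (use card_le[of s] card_le[of t] in simp)
    with tG show "t \<in> {t \<in> pverts G. bibfs_finds_shortest_within G s t ?b}" by simp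
  qed
  then have "card ({..<n} - ?far) \<le> card {t \<in> pverts G. bibfs_finds_shortest_within G s t ?b}"
    by (rule card_mono[rotated]) (simp add: verts)
  moreover have "card ({..<n} - ?far) = n - card ?far"
    by (subst card_Diff_subset) auto
  moreover have "card ?far \<le> n"
    using card_mono[of "{..<n}" ?far] by auto
  moreover have "card ?far \<le> \<delta> * n"
    using s verts \<delta> log_le by (intro card_far_le) auto
  ultimately have "(1 - \<delta>) * real n \<le> real (card {t \<in> pverts G. bibfs_finds_shortest_within G s t ?b})"
    by (simp add: algebra_simps)
  then show ?thesis unfolding m power_int_of_nat .
qed

end

text \<open>\<open>C\<close> is chosen before the graph and hence absolute. For \<open>d = 2\<close>
  the bound would be the constant \<open>C\<close>, which long odd cycles violate;
  \<open>0 < lam\<close> and \<open>lam < d\<close> make the base of the logarithm exceed 1.\<close>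

theorem theorem1:
  shows "\<exists>C::real. \<forall>(n::nat) (d::nat) (lam::real) (G :: nat pair_pre_digraph).
    ndl_graph n d lam G \<and> 0 < lam \<and> lam < real d \<and> d \<noteq> 2 \<longrightarrow>
    (\<forall>s\<in>pverts G. \<forall>\<delta>::real. 0 < \<delta> \<and> \<delta> < 1 \<longrightarrow>
      (1 - \<delta>) * real n \<le>
        real (card {t \<in> pverts G. bibfs_finds_shortest_within G s t
          (C * (real d - 1) powi \<lceil>1 / 4 * log (real d / lam) (real n / \<delta>)\<rceil>)}))"
proof (intro exI[of _ 6] allI impI ballI)
  fix n d lam G s and \<delta> :: real
  assume G: "ndl_graph n d lam G \<and> 0 < lam \<and> lam < real d \<and> d \<noteq> 2"
    and s: "s \<in> pverts G" and \<delta>: "0 < \<delta> \<and> \<delta> < 1"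
  then have "0 < n" by (auto simp: ndl_graph_def)
  with G interpret ndl n d lam G by unfold_locales auto
  show "(1 - \<delta>) * real n \<le> real (card {t \<in> pverts G. bibfs_finds_shortest_within G s t
      (6 * (real d - 1) powi \<lceil>1 / 4 * log (real d / lam) (real n / \<delta>)\<rceil>)})"
    using bibfs_bound G s \<delta> by blast
qed

end
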